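(* Let $d\ge 2$ be an integer. For every $d$-copula $C$ and every permutation $\pi\in S_d$, $$\max_{\boldsymbol{u}\in[0,1]^d}\lvert C(\boldsymbol{u})-C(\boldsymbol{u}_\pi)\rvert\le\frac{d-1}{d+1}.$$ The bound is best possible: for each integer $d\ge 2$ there exist a $d$-copula $C$, a permutation $\pi\in S_d$ and a vector $\boldsymbol{u}^\ast\in[0,1]^d$ such that $$\lvert C(\boldsymbol{u}^\ast)-C(\boldsymbol{u}^\ast_\pi)\rvert=\frac{d-1}{d+1}.$$
   Context: A $d$-copula is a function $C:[0,1]^d\to[0,1]$ that is the restriction to $[0,1]^d$ of the joint cumulative distribution function of a random vector $(U_1,\dots,U_d)$ whose components are each uniformly distributed on $[0,1]$. $S_d$ is the group of permutations of $\{1,\dots,d\}$. For $\boldsymbol{u}=(u_1,\dots,u_d)\in[0,1]^d$ and $\pi\in S_d$, $\boldsymbol{u}_\pi:=(u_{\pi(1)},\dots,u_{\pi(d)})$. *)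

theory Defs
  imports "HOL-Probability.Probability" "HOL-Combinatorics.Permutations"
begin

text \<open>Points of the cube are extensional functions on the index set \<open>{1..d}\<close>. For \<open>\<pi> permutes {1..d}\<close>
  the point \<open>u \<circ> \<pi>\<close> is again extensional, so it is the permuted vector \<open>(u(\<pi>(1)), \<dots>, u(\<pi>(d)))\<close>.\<close>

definition unit_cube :: "nat \<Rightarrow> (nat \<Rightarrow> real) set" where
  "unit_cube d = {1..d} \<rightarrow>\<^sub>E {0..1}"

text \<open>Only the values of \<open>C\<close> on the cube matter. An existential quantifier cannot range over types,
  so the sample space is fixed to be of type \<open>nat \<Rightarrow> real\<close>; by \<open>copulaI\<close> below this loses nothing.\<close>

definition copula :: "nat \<Rightarrow> ((nat \<Rightarrow> real) \<Rightarrow> real) \<Rightarrow> bool" where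
  "copula d C \<longleftrightarrow>
    (\<exists>(M :: (nat \<Rightarrow> real) measure) U.
       prob_space M \<and>
       (\<forall>i\<in>{1..d}. U i \<in> borel_measurable M \<and>
          distr M borel (U i) = uniform_measure lborel {0..1}) \<and>
       (\<forall>u\<in>unit_cube d. C u = measure M {\<omega> \<in> space M. \<forall>i\<in>{1..d}. U i \<omega> \<le> u i}))"

lemma copulaI:
  fixes M :: "'a measure" and U :: "nat \<Rightarrow> 'a \<Rightarrow> real"
  assumes "prob_space M"
    and meas: "\<And>i. i \<in> {1..d} \<Longrightarrow> U i \<in> borel_measurable M"
    and unif: "\<And>i. i \<in> {1..d} \<Longrightarrow> distr M borel (U i) = uniform_measure lborel {0..1}"
    and cdf: "\<And>u. u \<in> unit_cube d \<Longrightarrow>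
      C u = measure M {\<omega> \<in> space M. \<forall>i\<in>{1..d}. U i \<omega> \<le> u i}"
  shows "copula d C"
proof -
  interpret prob_space M by fact
  let ?P = "\<Pi>\<^sub>M i\<in>{1..d}. (borel :: real measure)"
  define X where "X = (\<lambda>\<omega>. \<lambda>i\<in>{1..d}. U i \<omega>)"
  have X: "X \<in> measurable M ?P"
    unfolding X_def by (intro measurable_restrict meas)
  define N where "N = distr M ?P X"
  have comp: "(\<lambda>x. x i) \<in> borel_measurable ?P" if "i \<in> {1..d}" for i
    using that by (rule measurable_component_singleton)
  have "prob_space N"
    unfolding N_def by (rule prob_space_distr[OF X])
  moreover have "(\<lambda>x. x i) \<in> borel_measurable N \<and>
      distr N borel (\<lambda>x. x i) = uniform_measure lborel {0..1}" if i: "i \<in> {1..d}" for i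
  proof -
    have "distr N borel (\<lambda>x. x i) = distr M borel ((\<lambda>x. x i) \<circ> X)"
      unfolding N_def by (rule distr_distr[OF comp[OF i] X])
    also have "(\<lambda>x. x i) \<circ> X = U i"
      using i by (auto simp: X_def)
    finally show ?thesis
      using unif[OF i] comp[OF i] by (simp add: N_def)
  qed
  moreover have "C u = measure N {x \<in> space N. \<forall>i\<in>{1..d}. x i \<le> u i}"
    if u: "u \<in> unit_cube d" for u
  proof -
    let ?A = "{x \<in> space ?P. \<forall>i\<in>{1..d}. x i \<le> u i}"
    have "{x \<in> space ?P. x i \<le> u i} \<in> sets ?P" if "i \<in> {1..d}" for i
      by (rule borel_measurable_le[OF comp[OF that] borel_measurable_const])
    then have "?A \<in> sets ?P"
      by (intro sets.sets_Collect_finite_All) auto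
    then have "measure N ?A = measure M (X -` ?A \<inter> space M)"
      unfolding N_def by (rule measure_distr[OF X])
    also have "X -` ?A \<inter> space M = {\<omega> \<in> space M. \<forall>i\<in>{1..d}. U i \<omega> \<le> u i}"
      using measurable_space[OF X] by (auto simp: X_def)
    finally show ?thesis
      using cdf[OF u] by (simp add: N_def)
  qed
  ultimately show ?thesis
    unfolding copula_def by (intro exI[of _ N] exI[of _ "\<lambda>i x. x i"]) blast
qed

end

theory Submission
  imports Defs
begin

text \<open>Let \<open>v = u \<circ> \<pi>\<close>, \<open>m = min u\<close> and \<open>\<delta> = C u - C v\<close>. The Lipschitz property gives
  \<open>\<delta> \<le> (\<Sum>i. (u i - v i)\<^sup>+) \<le> (\<Sum>i. u i) - d * m\<close>, and the two Frechet bounds give \<open>\<delta> \<le> m\<close> and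
  \<open>\<delta> \<le> m - ((\<Sum>i. u i) - d + 1)\<close>. Adding the first and third inequalities and using the second,
  \<open>(d + 1) * \<delta> \<le> d - 1\<close>.

  Equality is attained by shifts modulo 1 of a single uniform variable \<open>W\<close>: with \<open>n = d + 1\<close>, shift
  the \<open>i\<close>-th coordinate by \<open>c i = max 0 (2 * i / n - 1)\<close> and take \<open>u i = min 1 (1 - 2 / n + c i)\<close>.
  All coordinates are below \<open>u\<close> whenever \<open>W \<le> 1 - 2 / n\<close>, while the constraints of the reversed
  vector exclude intervals of \<open>W\<close> which together cover \<open>{0<..1}\<close>.\<close>

section \<open>The upper bound\<close>

lemma measure_uniform_distr_greaterThanAtMost:
  fixes X :: "'a \<Rightarrow> real"
  assumes X: "X \<in> borel_measurable M"
    and distr: "distr M borel X = uniform_measure lborel {0..1}"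
    and "0 \<le> a" "b \<le> 1"
  shows "measure M {\<omega> \<in> space M. a < X \<omega> \<and> X \<omega> \<le> b} = max 0 (b - a)"
proof -
  have "{\<omega> \<in> space M. a < X \<omega> \<and> X \<omega> \<le> b} = X -` {a<..b} \<inter> space M"
    by auto
  then have "measure M {\<omega> \<in> space M. a < X \<omega> \<and> X \<omega> \<le> b} = measure (distr M borel X) {a<..b}"
    using X by (simp add: measure_distr)
  also have "\<dots> = measure lborel ({0..1} \<inter> {a<..b})"
    unfolding distr by (subst measure_uniform_measure) auto
  also have "{0..1} \<inter> {a<..b} = {a<..b}"
    using assms(3,4) by auto
  finally show ?thesis
    by (cases "a \<le> b") auto
qed

lemma AE_uniform_distr_atLeastAtMost:
  fixes X :: "'a \<Rightarrow> real"
  assumes X: "X \<in> borel_measurable M"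
    and distr: "distr M borel X = uniform_measure lborel {0..1}"
  shows "AE \<omega> in M. 0 \<le> X \<omega> \<and> X \<omega> \<le> 1"
proof -
  have "AE x in uniform_measure lborel {0..1::real}. 0 \<le> x \<and> x \<le> 1"
    by (rule AE_uniform_measureI) auto
  then have "AE x in distr M borel X. 0 \<le> x \<and> x \<le> 1"
    unfolding distr .
  then show ?thesis
    using X by (subst (asm) AE_distr_iff) auto
qed

lemma unit_cubeD:
  assumes "u \<in> unit_cube d" "i \<in> {1..d}"
  shows "0 \<le> u i" "u i \<le> 1"
  using assms by (auto simp: unit_cube_def PiE_iff)

lemma copula_nonneg:
  assumes "copula d C" "u \<in> unit_cube d"
  shows "0 \<le> C u"
  using assms unfolding copula_def by force

text \<open>If every \<open>U i\<close> is at most \<open>u i\<close> but not every one is at most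
  \<open>v i\<close>, some \<open>U i\<close> lies in \<open>{v i<..u i}\<close>; a union bound adds
  up these lengths. Keeping positive parts rather than absolute values is what later gives the sharp
  constant.\<close>

lemma copula_diff_le:
  assumes "copula d C" and u: "u \<in> unit_cube d" and v: "v \<in> unit_cube d"
  shows "C u - C v \<le> (\<Sum>i\<in>{1..d}. max 0 (u i - v i))"
proof -
  from assms(1) obtain M :: "(nat \<Rightarrow> real) measure" and U where "prob_space M"
    and meas[measurable]: "\<And>i. i \<in> {1..d} \<Longrightarrow> U i \<in> borel_measurable M"
    and unif: "\<And>i. i \<in> {1..d} \<Longrightarrow> distr M borel (U i) = uniform_measure lborel {0..1}"
    and C: "\<And>u. u \<in> unit_cube d \<Longrightarrow> C u = measure M {\<omega> \<in> space M. \<forall>i\<in>{1..d}. U i \<omega> \<le> u i}"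
    unfolding copula_def by blast
  interpret prob_space M by fact
  define E where "E u = {\<omega> \<in> space M. \<forall>i\<in>{1..d}. U i \<omega> \<le> u i}" for u
  define S where "S i = {\<omega> \<in> space M. v i < U i \<omega> \<and> U i \<omega> \<le> u i}" for i
  have E[measurable]: "E u \<in> sets M" for u
    unfolding E_def by measurable
  have S[measurable]: "S i \<in> sets M" if "i \<in> {1..d}" for i
    unfolding S_def using meas[OF that] by measurable
  have U: "(\<Union>i\<in>{1..d}. S i) \<in> sets M"
    using S by blast
  have "C u = measure M (E u)" "C v = measure M (E v)"
    using u v by (simp_all add: C E_def)
  moreover have "E u \<subseteq> E v \<union> (\<Union>i\<in>{1..d}. S i)"
    by (auto simp: E_def S_def not_le)
  then have "measure M (E u) \<le> measure M (E v \<union> (\<Union>i\<in>{1..d}. S i))"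
    using U by (intro finite_measure_mono) auto
  moreover have "measure M (E v \<union> (\<Union>i\<in>{1..d}. S i)) \<le> measure M (E v) + measure M (\<Union>i\<in>{1..d}. S i)"
    using U by (intro measure_Un_le) auto
  moreover have "measure M (\<Union>i\<in>{1..d}. S i) \<le> (\<Sum>i\<in>{1..d}. measure M (S i))"
    using S by (intro finite_measure_subadditive_finite) auto
  moreover have "measure M (S i) = max 0 (u i - v i)" if "i \<in> {1..d}" for i
    unfolding S_def using unit_cubeD[OF u that] unit_cubeD[OF v that]
    by (intro measure_uniform_distr_greaterThanAtMost meas[OF that] unif[OF that])
  then have "(\<Sum>i\<in>{1..d}. measure M (S i)) = (\<Sum>i\<in>{1..d}. max 0 (u i - v i))"
    by (rule sum.cong[OF refl])
  ultimately show ?thesis by linarith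
qed

lemma copula_le_coordinate:
  assumes "copula d C" and u: "u \<in> unit_cube d" and i: "i \<in> {1..d}"
  shows "C u \<le> u i"
proof -
  from assms(1) obtain M :: "(nat \<Rightarrow> real) measure" and U where "prob_space M"
    and meas[measurable]: "\<And>i. i \<in> {1..d} \<Longrightarrow> U i \<in> borel_measurable M"
    and unif: "\<And>i. i \<in> {1..d} \<Longrightarrow> distr M borel (U i) = uniform_measure lborel {0..1}"
    and C: "\<And>u. u \<in> unit_cube d \<Longrightarrow> C u = measure M {\<omega> \<in> space M. \<forall>i\<in>{1..d}. U i \<omega> \<le> u i}"
    unfolding copula_def by blast
  interpret prob_space M by fact
  note [measurable] = meas[OF i]
  have "C u = measure M {\<omega> \<in> space M. \<forall>i\<in>{1..d}. U i \<omega> \<le> u i}"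
    using u by (rule C)
  \<comment> \<open>A uniform variable may be negative on a null set; discarding it places the event
    inside the preimage of \<open>{0..u i}\<close>.\<close>
  also have "\<dots> = measure M {\<omega> \<in> space M. 0 \<le> U i \<omega> \<and> (\<forall>i\<in>{1..d}. U i \<omega> \<le> u i)}"
    using AE_uniform_distr_atLeastAtMost[OF meas[OF i] unif[OF i]]
    by (intro finite_measure_eq_AE) auto
  also have "\<dots> \<le> measure M {\<omega> \<in> space M. 0 \<le> U i \<omega> \<and> U i \<omega> \<le> u i}"
    using i by (intro finite_measure_mono) auto
  also have "\<dots> = measure (distr M borel (U i)) {0..u i}"
    using meas[OF i] by (subst measure_distr) (auto intro!: arg_cong[where f = "measure M"])
  also have "\<dots> = measure lborel ({0..1} \<inter> {0..u i})"
    unfolding unif[OF i] by (subst measure_uniform_measure) auto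
  also have "{0..1} \<inter> {0..u i} = {0..u i}"
    using unit_cubeD[OF u i] by auto
  finally show ?thesis
    using unit_cubeD[OF u i] by simp
qed

lemma copula_one:
  assumes "copula d C"
  shows "C (\<lambda>i\<in>{1..d}. 1) = 1"
proof -
  from assms(1) obtain M :: "(nat \<Rightarrow> real) measure" and U where "prob_space M"
    and meas[measurable]: "\<And>i. i \<in> {1..d} \<Longrightarrow> U i \<in> borel_measurable M"
    and unif: "\<And>i. i \<in> {1..d} \<Longrightarrow> distr M borel (U i) = uniform_measure lborel {0..1}"
    and C: "\<And>u. u \<in> unit_cube d \<Longrightarrow> C u = measure M {\<omega> \<in> space M. \<forall>i\<in>{1..d}. U i \<omega> \<le> u i}"
    unfolding copula_def by blast
  interpret prob_space M by fact
  have "AE \<omega> in M. \<forall>i\<in>{1..d}. U i \<omega> \<le> 1"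
    using AE_uniform_distr_atLeastAtMost[OF meas unif] by (intro AE_finite_allI) auto
  then have "measure M {\<omega> \<in> space M. \<forall>i\<in>{1..d}. U i \<omega> \<le> 1} = 1"
    by (subst prob_Collect_eq_1) auto
  then show ?thesis
    by (subst C) (simp_all add: unit_cube_def del: atLeastAtMost_iff, simp)
qed

text \<open>This is \<open>copula_diff_le\<close> between the all-ones corner and \<open>u\<close>,
  where each positive part is just \<open>1 - u i\<close>.\<close>

lemma copula_Frechet_lower:
  assumes "copula d C" "u \<in> unit_cube d"
  shows "1 - (\<Sum>i\<in>{1..d}. 1 - u i) \<le> C u"
proof -
  have "(\<lambda>i\<in>{1..d}. 1) \<in> unit_cube d"
    by (auto simp: unit_cube_def)
  from copula_diff_le[OF assms(1) this assms(2)]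
  have "1 - C u \<le> (\<Sum>i\<in>{1..d}. max 0 ((\<lambda>i\<in>{1..d}. 1) i - u i))"
    by (simp only: copula_one[OF assms(1)])
  also have "\<dots> = (\<Sum>i\<in>{1..d}. 1 - u i)"
    using unit_cubeD[OF assms(2)] by (intro sum.cong) auto
  finally show ?thesis by simp
qed

lemma unit_cube_comp_permutes:
  assumes "u \<in> unit_cube d" "\<pi> permutes {1..d}"
  shows "u \<circ> \<pi> \<in> unit_cube d"
  using assms permutes_in_image[OF assms(2)]
  unfolding unit_cube_def PiE_iff extensional_def o_apply mem_Collect_eq by blast

lemma copula_diff_permute_le:
  assumes C: "copula d C" and \<pi>: "\<pi> permutes {1..d}" and u: "u \<in> unit_cube d" and "d \<ge> 1"
  shows "C u - C (u \<circ> \<pi>) \<le> (real d - 1) / (real d + 1)"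
proof -
  define m where "m = Min (u ` {1..d})"
  define \<delta> where "\<delta> = C u - C (u \<circ> \<pi>)"
  have v: "u \<circ> \<pi> \<in> unit_cube d"
    by (rule unit_cube_comp_permutes[OF u \<pi>])
  have m_le: "m \<le> u i" if "i \<in> {1..d}" for i
    using that by (simp add: m_def)
  \<comment> \<open>The minimum is attained, so the coordinate bound at a minimiser gives
    \<open>C u \<le> m\<close>.\<close>
  have "m \<in> u ` {1..d}"
    unfolding m_def using \<open>d \<ge> 1\<close> by (intro Min_in) auto
  then have Cm: "C u \<le> m"
    using copula_le_coordinate[OF C u] by auto
  have "\<delta> \<le> (\<Sum>i\<in>{1..d}. max 0 (u i - (u \<circ> \<pi>) i))"
    unfolding \<delta>_def by (rule copula_diff_le[OF C u v])
  \<comment> \<open>Both \<open>u i\<close> and \<open>u (\<pi> i)\<close> are at least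
    \<open>m\<close>, so the positive part is at most \<open>u i - m\<close>.\<close>
  also have "\<dots> \<le> (\<Sum>i\<in>{1..d}. u i - m)"
    using m_le permutes_in_image[OF \<pi>] by (intro sum_mono) fastforce
  finally have 1: "\<delta> \<le> (\<Sum>i\<in>{1..d}. u i) - d * m"
    by (simp add: sum_subtractf)
  have "(\<Sum>i\<in>{1..d}. (u \<circ> \<pi>) i) = (\<Sum>i\<in>{1..d}. u i)"
    using sum.permute[OF \<pi>, of u] by (simp add: o_def)
  then have 2: "\<delta> \<le> m - (1 - real d + (\<Sum>i\<in>{1..d}. u i))"
    using copula_Frechet_lower[OF C v] Cm by (simp add: \<delta>_def sum_subtractf)
  have 3: "\<delta> \<le> m"
    using copula_nonneg[OF C v] Cm by (simp add: \<delta>_def)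
  \<comment> \<open>Adding \<open>1\<close> and \<open>2\<close> cancels the coordinate sum and
    leaves \<open>2 * \<delta> \<le> (d - 1) * (1 - m)\<close>; \<open>3\<close> then trades
    \<open>m\<close> for \<open>\<delta>\<close>.\<close>
  have "(real d - 1) * \<delta> \<le> (real d - 1) * m"
    using 3 \<open>d \<ge> 1\<close> by (intro mult_left_mono) auto
  with 1 2 have "\<delta> * (real d + 1) \<le> real d - 1"
    by (simp add: algebra_simps)
  then show ?thesis
    by (simp add: \<delta>_def pos_le_divide_eq)
qed

text \<open>The opposite sign is the one-sided bound at the point \<open>u \<circ> \<pi>\<close>
  with the permutation \<open>inv \<pi>\<close>.\<close>

lemma copula_abs_diff_permute_le:
  assumes C: "copula d C" and \<pi>: "\<pi> permutes {1..d}" and u: "u \<in> unit_cube d" and "d \<ge> 1"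
  shows "\<bar>C u - C (u \<circ> \<pi>)\<bar> \<le> (real d - 1) / (real d + 1)"
proof -
  have "u \<circ> \<pi> \<circ> inv \<pi> = u"
    using permutes_inv_o(1)[OF \<pi>] by (simp add: o_assoc[symmetric])
  then have "C (u \<circ> \<pi>) - C u \<le> (real d - 1) / (real d + 1)"
    using copula_diff_permute_le[OF C permutes_inv[OF \<pi>] unit_cube_comp_permutes[OF u \<pi>] \<open>d \<ge> 1\<close>]
    by simp
  with copula_diff_permute_le[OF assms] show ?thesis by linarith
qed

section \<open>Existence of the maximum\<close>

text \<open>The ambient topology is the product over all natural indices, so the cube is rewritten
  as a full product with factors \<open>{undefined}\<close> outside \<open>{1..d}\<close>;
  Tychonoff's theorem applies.\<close>

lemma compact_unit_cube: "compact (unit_cube d)"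
proof -
  have "unit_cube d = (\<Pi>\<^sub>E i\<in>UNIV. if i \<in> {1..d} then {0..1} else {undefined})"
    by (auto simp: unit_cube_def PiE_iff extensional_def split: if_splits)
  moreover have "compactin (product_topology (\<lambda>i. euclidean) UNIV)
      (\<Pi>\<^sub>E i\<in>UNIV. if i \<in> {1..d} then {0..1::real} else {undefined})"
    by (simp add: compactin_PiE)
  ultimately show ?thesis
    by (simp add: euclidean_product_topology)
qed

text \<open>\<open>copula_diff_le\<close> in both directions makes \<open>C\<close> 1-Lipschitz for
  the l1 distance, which is a finite sum of continuous coordinate functions.\<close>

lemma continuous_on_copula:
  assumes C: "copula d C"
  shows "continuous_on (unit_cube d) C"
  unfolding continuous_on_def
proof
  fix u assume u: "u \<in> unit_cube d"
  have "\<bar>C v - C u\<bar> \<le> (\<Sum>i\<in>{1..d}. \<bar>v i - u i\<bar>)" if v: "v \<in> unit_cube d" for v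
  proof -
    have "C v - C u \<le> (\<Sum>i\<in>{1..d}. \<bar>v i - u i\<bar>)"
      by (rule order_trans[OF copula_diff_le[OF C v u]], rule sum_mono) auto
    moreover have "C u - C v \<le> (\<Sum>i\<in>{1..d}. \<bar>v i - u i\<bar>)"
      by (rule order_trans[OF copula_diff_le[OF C u v]], rule sum_mono) auto
    ultimately show ?thesis by linarith
  qed
  then have "\<forall>\<^sub>F v in at u within unit_cube d. norm (C v - C u) \<le> (\<Sum>i\<in>{1..d}. \<bar>v i - u i\<bar>)"
    by (auto simp: eventually_at_filter)
  moreover have "continuous_on UNIV (\<lambda>v. \<Sum>i\<in>{1..d}. \<bar>v i - u i\<bar>)"
    by (intro continuous_intros continuous_on_product_coordinates)
  then have "((\<lambda>v. \<Sum>i\<in>{1..d}. \<bar>v i - u i\<bar>) \<longlongrightarrow> (\<Sum>i\<in>{1..d}. \<bar>u i - u i\<bar>)) (at u within unit_cube d)"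
    unfolding continuous_on_def by (blast intro: tendsto_within_subset)
  then have "((\<lambda>v. \<Sum>i\<in>{1..d}. \<bar>v i - u i\<bar>) \<longlongrightarrow> 0) (at u within unit_cube d)"
    by simp
  ultimately have "((\<lambda>v. C v - C u) \<longlongrightarrow> 0) (at u within unit_cube d)"
    by (rule Lim_null_comparison)
  then show "(C \<longlongrightarrow> C u) (at u within unit_cube d)"
    by (rule LIM_zero_cancel)
qed

lemma copula_abs_diff_permute_attains_sup:
  assumes C: "copula d C" and \<pi>: "\<pi> permutes {1..d}"
  shows "\<exists>v\<in>unit_cube d. \<forall>u\<in>unit_cube d. \<bar>C u - C (u \<circ> \<pi>)\<bar> \<le> \<bar>C v - C (v \<circ> \<pi>)\<bar>"
proof (rule continuous_attains_sup[OF compact_unit_cube])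
  show "unit_cube d \<noteq> {}"
    by (auto simp: unit_cube_def PiE_eq_empty_iff)
  have "continuous_on (unit_cube d) (\<lambda>u::nat \<Rightarrow> real. u \<circ> \<pi>)"
    unfolding o_def
    by (intro continuous_on_coordinatewise_then_product
        continuous_on_subset[OF continuous_on_product_coordinates]) auto
  then have "continuous_on (unit_cube d) (\<lambda>u. C (u \<circ> \<pi>))"
    using unit_cube_comp_permutes[OF _ \<pi>]
    by (intro continuous_on_compose2[OF continuous_on_copula[OF C]]) auto
  then show "continuous_on (unit_cube d) (\<lambda>u. \<bar>C u - C (u \<circ> \<pi>)\<bar>)"
    by (intro continuous_intros continuous_on_copula[OF C])
qed

section \<open>Sharpness\<close>

text \<open>Addition modulo 1 with representatives in \<open>{0<..1}\<close> rather than \<open>{0..<1}\<close>, so that no null set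
  of exceptional points arises below.\<close>

definition circle_shift :: "real \<Rightarrow> real \<Rightarrow> real" where
  "circle_shift c x = (if x + c \<le> 1 then x + c else x + c - 1)"

lemma borel_measurable_circle_shift [measurable]: "circle_shift c \<in> borel_measurable borel"
  unfolding circle_shift_def by measurable

lemma prob_space_uniform_greaterThanAtMost: "prob_space (uniform_measure lborel {0<..1::real})"
  by (rule prob_space_uniform_measure) auto

text \<open>Rotations of the circle preserve Lebesgue measure; this is verified on distribution
  functions.\<close>

lemma distr_circle_shift:
  assumes c: "0 \<le> c" "c \<le> 1"
  shows "distr (uniform_measure lborel {0<..1}) borel (circle_shift c) = uniform_measure lborel {0..1}"
proof -
  let ?M = "uniform_measure lborel {0<..1::real}"
  interpret prob_space ?M by (rule prob_space_uniform_greaterThanAtMost)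
  have "distributed ?M lborel (circle_shift c) (\<lambda>x. indicator {0..1} x / measure lborel {0..1::real})"
  proof (rule uniform_distrI_borel_atLeastAtMost)
    fix t :: real assume t: "0 \<le> t" "t \<le> 1"
    have "measure ?M {x \<in> space ?M. circle_shift c x \<le> t}
        = measure lborel ({0<..1} \<inter> {x. circle_shift c x \<le> t})"
      by (subst measure_uniform_measure) auto
    also have "\<dots> = t"
    \<comment> \<open>The preimage of \<open>{0<..t}\<close> is an arc starting at
      \<open>1 - c\<close>: one interval if \<open>t \<le> c\<close>, otherwise it wraps past 1 and
      splits in two.\<close>
    proof (cases "t \<le> c")
      case True
      with t c have "{0<..1} \<inter> {x. circle_shift c x \<le> t} = {1 - c<..t + 1 - c}"
        by (auto simp: circle_shift_def)
      then show ?thesis using t by simp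
    next
      case False
      with t c have "{0<..1} \<inter> {x. circle_shift c x \<le> t} = {0<..t - c} \<union> {1 - c<..1}"
        by (auto simp: circle_shift_def)
      moreover have "measure lborel ({0<..t - c} \<union> {1 - c<..1}) =
          measure lborel {0<..t - c} + measure lborel {1 - c<..1}"
        using t c False by (intro measure_Union) auto
      ultimately show ?thesis using False c by simp
    qed
    finally show "measure ?M {x \<in> space ?M. circle_shift c x \<le> t} = (t - 0) / (1 - 0)"
      by simp
  qed simp_all
  moreover have "distr ?M borel (circle_shift c) = distr ?M lborel (circle_shift c)"
    by (rule distr_cong) auto
  ultimately show ?thesis
    by (simp add: uniform_measure_def distributed_distr_eq_density ennreal_indicator
        divide_ennreal_def)
qed

text \<open>The joint distribution function of \<open>d\<close> rotations of one uniform variable on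
  \<open>{0<..1}\<close>.\<close>

definition shift_copula :: "nat \<Rightarrow> (nat \<Rightarrow> real) \<Rightarrow> (nat \<Rightarrow> real) \<Rightarrow> real" where
  "shift_copula d c u = measure lborel {x \<in> {0<..1}. \<forall>i\<in>{1..d}. circle_shift (c i) x \<le> u i}"

lemma copula_shift_copula:
  assumes "\<And>i. i \<in> {1..d} \<Longrightarrow> 0 \<le> c i \<and> c i \<le> 1"
  shows "copula d (shift_copula d c)"
proof (rule copulaI[where M = "uniform_measure lborel {0<..1::real}" and U = "\<lambda>i. circle_shift (c i)"])
  show "prob_space (uniform_measure lborel {0<..1::real})"
    by (rule prob_space_uniform_greaterThanAtMost)
next
  fix u :: "nat \<Rightarrow> real"
  have "{x \<in> {0<..1::real}. \<forall>i\<in>{1..d}. circle_shift (c i) x \<le> u i} =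
      {0<..1} \<inter> {x. \<forall>i\<in>{1..d}. circle_shift (c i) x \<le> u i}"
    by auto
  then show "shift_copula d c u = measure (uniform_measure lborel {0<..1::real})
      {x \<in> space (uniform_measure lborel {0<..1}). \<forall>i\<in>{1..d}. circle_shift (c i) x \<le> u i}"
    unfolding shift_copula_def by (subst measure_uniform_measure) auto
qed (use assms in \<open>auto simp: distr_circle_shift\<close>)

text \<open>For \<open>x\<close> in \<open>{0<..m}\<close>, a shift that does not wrap is at most
  \<open>m + c i\<close>; one that wraps forces \<open>m + c i > 1\<close>, so
  \<open>u i = 1\<close> and the constraint is vacuous.\<close>

lemma shift_copula_ge:
  assumes "0 \<le> m" "m \<le> 1"
    and u: "\<And>i. i \<in> {1..d} \<Longrightarrow> 0 \<le> c i \<and> u i = min 1 (m + c i) \<and> c i \<le> 1"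
  shows "m \<le> shift_copula d c u"
proof -
  have "m = measure lborel {0<..m}"
    using assms by simp
  also have "\<dots> \<le> measure lborel {x \<in> {0<..1}. \<forall>i\<in>{1..d}. circle_shift (c i) x \<le> u i}"
  proof (rule measure_mono_fmeasurable)
    show "{0<..m} \<subseteq> {x \<in> {0<..1}. \<forall>i\<in>{1..d}. circle_shift (c i) x \<le> u i}"
      using assms by (fastforce simp: circle_shift_def)
    show "{x \<in> {0<..1}. \<forall>i\<in>{1..d}. circle_shift (c i) x \<le> u i} \<in> fmeasurable lborel"
      by (rule fmeasurableI2[of "{0..1}"]) (auto simp: fmeasurable_def)
  qed auto
  finally show ?thesis
    by (simp add: shift_copula_def)
qed

text \<open>With \<open>n = d + 1\<close>, the intervals
  \<open>{(2 * j - 2) / n<..2 * j / n}\<close> for \<open>j \<ge> 1\<close> cover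
  \<open>{0<..1}\<close>; if \<open>x\<close> lies in the \<open>j\<close>-th, coordinate
  \<open>d + 1 - j\<close> violates its constraint.\<close>

lemma reversed_shift_constraints_infeasible:
  fixes d :: nat and c v :: "nat \<Rightarrow> real"
  assumes "d \<ge> 2" "0 < x" "x \<le> 1"
    and c: "\<And>i. c i = max 0 (2 * real i / (real d + 1) - 1)"
    and v: "\<And>i. i \<in> {1..d} \<Longrightarrow> v i = min 1 ((real d - 1) / (real d + 1) + c (d + 1 - i))"
  shows "\<exists>i\<in>{1..d}. v i < circle_shift (c i) x"
proof -
  define n where "n = real d + 1"
  have n: "n > 0" by (simp add: n_def)
  define j where "j = nat \<lceil>x * n / 2\<rceil>"
  have "0 < x * n / 2"
    using assms n by simp
  then have j: "real j - 1 < x * n / 2" "x * n / 2 \<le> real j" "j \<ge> 1"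
    unfolding j_def by linarith+
  have x1: "(2 * real j - 2) / n < x" and x2: "x \<le> 2 * real j / n"
    using j n by (simp_all add: field_simps)
  have xn: "x * n \<le> n"
    using assms n by simp
  then have jn: "2 * j < d + 3"
    using j(1) unfolding n_def by linarith
  \<comment> \<open>The second case arises only for even \<open>d\<close>: the last interval starts
    at \<open>1 - 1 / n\<close> and sticks out beyond 1, and \<open>c j\<close> is positive.\<close>
  consider "2 * j \<le> d + 1" | "2 * j = d + 2"
    using jn by linarith
  then show ?thesis
  proof cases
    case 1
    define i where "i = d + 1 - j"
    have i: "i \<in> {1..d}" "real i = n - real j" "d + 1 - i = j"
      using 1 j(3) \<open>d \<ge> 2\<close> by (auto simp: i_def n_def)
    have "2 * real j \<le> n"
      using 1 unfolding n_def by linarith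
    then have ci: "c i = 1 - 2 * real j / n" and cj: "c j = 0"
      using n i by (auto simp: c n_def[symmetric] field_simps)
    have vi: "v i \<le> 1 - 2 / n"
      unfolding v[OF i(1)] i(3) cj by (rule min.coboundedI2) (simp add: n_def field_simps)
    \<comment> \<open>The right end \<open>x \<le> 2 * j / n\<close> of the interval is exactly the
      condition for not wrapping.\<close>
    have "circle_shift (c i) x = x + 1 - 2 * real j / n"
      using x2 by (auto simp: circle_shift_def ci)
    also have "\<dots> > 1 - 2 / n"
      using x1 by (simp add: diff_divide_distrib)
    finally show ?thesis
      using vi i(1) by force
  next
    case 2
    define i where "i = j - 1"
    have i: "i \<in> {1..d}" "2 * real i = n - 1" "d + 1 - i = j" "2 * real j = n + 1"
      using 2 j(3) \<open>d \<ge> 2\<close> by (auto simp: i_def n_def)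
    have ci: "c i = 0" and cj: "c j = 1 / n"
      using n i by (auto simp: c n_def[symmetric] field_simps)
    have vi: "v i \<le> 1 - 1 / n"
      unfolding v[OF i(1)] i(3) cj by (rule min.coboundedI2) (simp add: n_def field_simps)
    have "circle_shift (c i) x = x"
      using \<open>x \<le> 1\<close> by (simp add: circle_shift_def ci)
    moreover have "1 - 1 / n < x"
      using x1 i(4) n by (simp add: field_simps)
    ultimately show ?thesis
      using vi i(1) by force
  qed
qed

lemma exists_copula_permute_diff:
  assumes "d \<ge> 2"
  shows "\<exists>C \<pi>. copula d C \<and> \<pi> permutes {1..d} \<and>
           (\<exists>u\<in>unit_cube d. \<bar>C u - C (u \<circ> \<pi>)\<bar> = (real d - 1) / (real d + 1))"
proof -
  define m where "m = (real d - 1) / (real d + 1)"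
  define c where "c i = max 0 (2 * real i / (real d + 1) - 1)" for i :: nat
  define u where "u = (\<lambda>i\<in>{1..d}. min 1 (m + c i))"
  \<comment> \<open>The reversal, extended by the identity as \<open>permutes\<close>
    demands.\<close>
  define \<pi> where "\<pi> i = (if i \<in> {1..d} then d + 1 - i else i)" for i
  have m: "0 \<le> m" "m \<le> 1"
    using assms by (auto simp: m_def field_simps)
  have c: "0 \<le> c i \<and> c i \<le> 1" if "i \<in> {1..d}" for i
    using that by (auto simp: c_def field_simps)
  have \<pi>: "\<pi> permutes {1..d}"
  proof (rule bij_imp_permutes)
    show "bij_betw \<pi> {1..d} {1..d}"
      by (rule bij_betw_byWitness[where f' = \<pi>]) (auto simp: \<pi>_def)
  qed (auto simp: \<pi>_def)
  have u: "u \<in> unit_cube d"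
    using m c by (auto simp: unit_cube_def u_def)
  have C: "copula d (shift_copula d c)"
    using c by (rule copula_shift_copula)
  have "m \<le> shift_copula d c u"
    using m c by (intro shift_copula_ge) (auto simp: u_def)
  moreover have "(u \<circ> \<pi>) i = min 1 ((real d - 1) / (real d + 1) + c (d + 1 - i))" if "i \<in> {1..d}" for i
    using that by (auto simp: u_def \<pi>_def m_def)
  then have "{x \<in> {0<..1}. \<forall>i\<in>{1..d}. circle_shift (c i) x \<le> (u \<circ> \<pi>) i} = {}"
    using reversed_shift_constraints_infeasible[OF assms _ _ c_def, of _ "u \<circ> \<pi>"]
    by (auto simp: not_le[symmetric] simp del: o_apply)
  then have "shift_copula d c (u \<circ> \<pi>) = 0"
    by (simp only: shift_copula_def measure_empty)
  \<comment> \<open>The general upper bound closes the gap, so the value at \<open>u\<close> only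
    had to be estimated from below.\<close>
  moreover have "\<bar>shift_copula d c u - shift_copula d c (u \<circ> \<pi>)\<bar> \<le> m"
    unfolding m_def using assms by (intro copula_abs_diff_permute_le[OF C \<pi> u]) auto
  ultimately have "\<bar>shift_copula d c u - shift_copula d c (u \<circ> \<pi>)\<bar> = m"
    by linarith
  with C \<pi> u show ?thesis
    unfolding m_def by blast
qed

text \<open>The maximum is expressed through a maximiser \<open>v\<close>, so that its existence is
  part of the claim.\<close>

theorem theorem1:
  fixes d :: nat
  assumes "d \<ge> 2"
  shows "(\<forall>C \<pi>. copula d C \<and> \<pi> permutes {1..d} \<longrightarrow>
            (\<exists>v\<in>unit_cube d.
               (\<forall>u\<in>unit_cube d. \<bar>C u - C (u \<circ> \<pi>)\<bar> \<le> \<bar>C v - C (v \<circ> \<pi>)\<bar>) \<and>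
               \<bar>C v - C (v \<circ> \<pi>)\<bar> \<le> (real d - 1) / (real d + 1)))
       \<and> (\<exists>C \<pi>. copula d C \<and> \<pi> permutes {1..d} \<and>
            (\<exists>u\<in>unit_cube d. \<bar>C u - C (u \<circ> \<pi>)\<bar> = (real d - 1) / (real d + 1)))"
proof (rule conjI[OF _ exists_copula_permute_diff[OF assms]], intro allI impI, elim conjE)
  fix C \<pi> assume C: "copula d C" and \<pi>: "\<pi> permutes {1..d}"
  obtain v where "v \<in> unit_cube d"
    "\<forall>u\<in>unit_cube d. \<bar>C u - C (u \<circ> \<pi>)\<bar> \<le> \<bar>C v - C (v \<circ> \<pi>)\<bar>"
    using copula_abs_diff_permute_attains_sup[OF C \<pi>] by blast
  moreover from this(1) have "\<bar>C v - C (v \<circ> \<pi>)\<bar> \<le> (real d - 1) / (real d + 1)"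
    using assms by (intro copula_abs_diff_permute_le[OF C \<pi>]) auto
  ultimately show "\<exists>v\<in>unit_cube d.
      (\<forall>u\<in>unit_cube d. \<bar>C u - C (u \<circ> \<pi>)\<bar> \<le> \<bar>C v - C (v \<circ> \<pi>)\<bar>) \<and>
      \<bar>C v - C (v \<circ> \<pi>)\<bar> \<le> (real d - 1) / (real d + 1)"
    by blast
qed

end
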